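(* For every integer $n\ge 1$, $$ SOME(n)+4\sum_{i=1}^{\lfloor n/2\rfloor}p(n-2i)\,\sigma(i)=n\,p(n), $$ where $\lfloor\cdot\rfloor$ denotes the floor function.
   Context: A partition of a positive integer $n$ is a non-increasing finite sequence of positive integers (its parts) with sum $n$. $p(n)$ is the number of partitions of $n$, with $p(0)=1$. $SOME(n)$ is the sum of all odd parts in all partitions of $n$ minus the sum of all even parts in all partitions of $n$ (parts counted with multiplicity). $\sigma(n)=\sum_{d\mid n}d$ is the sum-of-divisors function. *)

theory Defs
  imports Main
begin

definition partitions :: "nat \<Rightarrow> nat list set" where
  "partitions n = {xs. sorted_wrt (\<ge>) xs \<and> (\<forall>x\<in>set xs. 0 < x) \<and> sum_list xs = n}"

definition p :: "nat \<Rightarrow> nat" where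
  "p n = card (partitions n)"

(* The filtered lists keep repeated parts, so parts are counted with multiplicity. The
   difference can be negative, hence the result is an integer. *)
definition SOME_diff :: "nat \<Rightarrow> int" where
  "SOME_diff n =
     int (\<Sum>xs\<in>partitions n. sum_list (filter odd xs)) -
     int (\<Sum>xs\<in>partitions n. sum_list (filter even xs))"

(* Intended for n > 0; every number divides 0. *)
definition sigma :: "nat \<Rightarrow> nat" where
  "sigma n = (\<Sum>d | d dvd n. d)"

(* Without finiteness, card and sum over partitions n would be 0 by convention. *)
lemma finite_partitions: "finite (partitions n)"
proof (rule finite_subset)
  have "length xs \<le> sum_list xs" if "\<forall>x\<in>set xs. 0 < x" for xs :: "nat list"
    using that by (induction xs) auto
  then show "partitions n \<subseteq> {xs. set xs \<subseteq> {..n} \<and> length xs \<le> n}"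
    by (auto simp: partitions_def member_le_sum_list)
  show "finite {xs. set xs \<subseteq> {..n} \<and> length xs \<le> n}"
    by (rule finite_lists_length_le) simp
qed

lemma p_0: "p 0 = 1"
proof -
  have "partitions 0 = {[]}"
  proof
    show "partitions 0 \<subseteq> {[]}"
    proof
      fix xs assume "xs \<in> partitions 0"
      then show "xs \<in> {[]}" by (cases xs) (auto simp: partitions_def)
    qed
  qed (simp add: partitions_def)
  then show ?thesis by (simp add: p_def)
qed

end

theory Submission
  imports Defs "HOL-Library.Multiset"
begin

text \<open>
  Odd and even parts together contribute \<open>n p(n)\<close>, so the claim says that the even parts contribute
  \<open>E(n) = 2 \<Sum>\<^sub>i p(n - 2 i) \<sigma>(i)\<close>. Removing \<open>m\<close> copies of \<open>k\<close> shows that exactly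
  \<open>p(n - m k)\<close> partitions contain \<open>k\<close> at least \<open>m\<close> times. Hence \<open>k\<close> occurs
  \<open>\<Sum>\<^sub>m p(n - m k)\<close> times altogether; put \<open>k = 2 j\<close>, weight by \<open>k\<close> and collect the pairs
  \<open>(j, m)\<close> with \<open>j m = i\<close>.
\<close>

text \<open>With multisets, adding or removing copies of a part is plain sum or difference, with no
  order to restore.\<close>

definition mset_partitions :: "nat \<Rightarrow> nat multiset set" where
  "mset_partitions n = {M. 0 \<notin># M \<and> sum_mset M = n}"

lemma bij_betw_mset_partitions: "bij_betw mset (partitions n) (mset_partitions n)"
proof (rule bij_betw_byWitness[where f' = "\<lambda>M. rev (sorted_list_of_multiset M)"])
  show "\<forall>xs\<in>partitions n. rev (sorted_list_of_multiset (mset xs)) = xs"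
  proof
    fix xs assume "xs \<in> partitions n"
    then have "sorted (rev xs)"
      by (simp add: partitions_def sorted_wrt_rev)
    then have "sort xs = rev xs"
      by (intro properties_for_sort) auto
    then show "rev (sorted_list_of_multiset (mset xs)) = xs"
      by simp
  qed
  show "mset ` partitions n \<subseteq> mset_partitions n"
    by (auto simp: partitions_def mset_partitions_def sum_mset_sum_list)
  have "sum_list (sorted_list_of_multiset M) = sum_mset M" for M :: "nat multiset"
    by (metis mset_sorted_list_of_multiset sum_mset_sum_list)
  then show "(\<lambda>M. rev (sorted_list_of_multiset M)) ` mset_partitions n \<subseteq> partitions n"
    by (auto simp: partitions_def mset_partitions_def sorted_wrt_rev intro: gr0I)
qed simp

lemma finite_mset_partitions: "finite (mset_partitions n)"
  using bij_betw_finite[OF bij_betw_mset_partitions] finite_partitions by blast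

lemma p_eq_card_mset_partitions: "p n = card (mset_partitions n)"
  unfolding p_def by (rule bij_betw_same_card[OF bij_betw_mset_partitions])

text \<open>The copies of \<open>k\<close> alone form a submultiset. This bounds every multiplicity
  in a partition of \<open>n\<close>.\<close>

lemma count_times_le_sum_mset: "count M k * k \<le> sum_mset M" for M :: "nat multiset"
proof -
  have "replicate_mset (count M k) k \<subseteq># M"
    by (simp flip: count_le_replicate_mset_subset_eq)
  then have "sum_mset (replicate_mset (count M k) k) \<le> sum_mset M"
    by (metis le_add1 subset_mset.add_diff_inverse sum_mset.union)
  then show ?thesis by simp
qed

text \<open>Adding and removing \<open>m\<close> copies of \<open>k\<close> are mutually inverse;
  \<open>0 < k\<close> keeps the added parts positive. The case split matters: for
  \<open>m * k > n\<close> truncated subtraction would yield \<open>p 0 = 1\<close> instead of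
  0.\<close>

lemma card_mset_partitions_count_ge:
  assumes "0 < k"
  shows "card {M \<in> mset_partitions n. m \<le> count M k} = (if m * k \<le> n then p (n - m * k) else 0)"
proof (cases "m * k \<le> n")
  case True
  let ?R = "replicate_mset m k"
  have "bij_betw (\<lambda>M. M + ?R) (mset_partitions (n - m * k)) {M \<in> mset_partitions n. m \<le> count M k}"
  proof (rule bij_betw_byWitness[where f' = "\<lambda>M. M - ?R"])
    show "\<forall>M\<in>{M \<in> mset_partitions n. m \<le> count M k}. M - ?R + ?R = M"
      by (auto simp: count_le_replicate_mset_subset_eq)
    show "(\<lambda>M. M + ?R) ` mset_partitions (n - m * k) \<subseteq> {M \<in> mset_partitions n. m \<le> count M k}"
      using assms True by (auto simp: mset_partitions_def split: if_splits)
    have "sum_mset (M - ?R) = sum_mset M - m * k" if "m \<le> count M k" for M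
      using that by (simp add: count_le_replicate_mset_subset_eq sum_mset_diff)
    then show "(\<lambda>M. M - ?R) ` {M \<in> mset_partitions n. m \<le> count M k} \<subseteq> mset_partitions (n - m * k)"
      by (auto simp: mset_partitions_def dest: in_diffD)
  qed simp
  then show ?thesis
    using True by (simp add: p_eq_card_mset_partitions bij_betw_same_card)
next
  case False
  have "m * k \<le> n" if "M \<in> mset_partitions n" "m \<le> count M k" for M
    using le_trans[OF mult_le_mono1[OF that(2)] count_times_le_sum_mset] that(1)
    by (simp add: mset_partitions_def)
  then have "{M \<in> mset_partitions n. m \<le> count M k} = {}"
    using False by blast
  with False show ?thesis by (simp only: card.empty if_False)
qed

lemma le_of_mult_le:
  fixes m k n :: nat
  assumes "m * k \<le> n" "0 < k"
  shows "m \<le> n"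
  using assms mult_le_mono2[of 1 k m] by linarith

lemma sum_count_mset_partitions:
  assumes "0 < k"
  shows "(\<Sum>M\<in>mset_partitions n. count M k) = (\<Sum>m | 1 \<le> m \<and> m * k \<le> n. p (n - m * k))"
proof -
  \<comment> \<open>A multiplicity is the number of thresholds \<open>m \<ge> 1\<close> that it
    reaches. The range \<open>{1..n}\<close> does not depend on \<open>M\<close>, so the two sums
    can be swapped.\<close>
  have count: "count M k = (\<Sum>m=1..n. of_bool (m \<le> count M k))" if "M \<in> mset_partitions n" for M
  proof -
    have "count M k \<le> count M k * k"
      using assms by simp
    also have "\<dots> \<le> n"
      using that count_times_le_sum_mset[of M k] by (simp add: mset_partitions_def)
    finally have "{1..n} \<inter> {m. m \<le> count M k} = {1..count M k}"
      by auto
    then show ?thesis by simp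
  qed
  have "(\<Sum>M\<in>mset_partitions n. count M k)
      = (\<Sum>M\<in>mset_partitions n. \<Sum>m=1..n. of_bool (m \<le> count M k))"
    by (intro sum.cong refl count)
  also have "\<dots> = (\<Sum>m=1..n. \<Sum>M\<in>mset_partitions n. of_bool (m \<le> count M k))"
    by (rule sum.swap)
  also have "\<dots> = (\<Sum>m=1..n. card {M \<in> mset_partitions n. m \<le> count M k})"
    by (simp add: finite_mset_partitions Int_def)
  also have "\<dots> = (\<Sum>m\<in>{1..n}. if m * k \<le> n then p (n - m * k) else 0)"
    by (simp add: card_mset_partitions_count_ge[OF assms])
  also have "\<dots> = (\<Sum>m | m \<in> {1..n} \<and> m * k \<le> n. p (n - m * k))"
    by (rule sum.inter_filter[symmetric]) simp
  also have "{m. m \<in> {1..n} \<and> m * k \<le> n} = {m. 1 \<le> m \<and> m * k \<le> n}"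
    using assms by (auto intro: le_of_mult_le)
  finally show ?thesis .
qed

text \<open>Elements of \<open>A\<close> outside \<open>M\<close> contribute 0. Summing over a fixed
  superset of the support keeps the index set constant during the induction.\<close>

lemma sum_mset_eq_sum_count:
  fixes M :: "nat multiset"
  assumes "finite A" "set_mset M \<subseteq> A"
  shows "sum_mset M = (\<Sum>k\<in>A. k * count M k)"
  using assms(2)
proof (induction M)
  case (add x M)
  have "(\<Sum>k\<in>A. k * count (add_mset x M) k) = (\<Sum>k\<in>A. k * count M k + (if k = x then k else 0))"
    by (intro sum.cong) auto
  with add assms(1) show ?case
    by (simp add: sum.distrib sum.delta)
qed simp

text \<open>Each even part is some \<open>2 * j\<close>. The generous upper bound
  \<open>sum_mset M\<close> gives all partitions of \<open>n\<close> the same range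
  \<open>{1..n}\<close>; values \<open>2 * j\<close> too large to occur have count 0.\<close>

lemma sum_mset_filter_even:
  fixes M :: "nat multiset"
  assumes "0 \<notin># M"
  shows "sum_mset (filter_mset even M) = (\<Sum>j=1..sum_mset M. 2 * j * count M (2 * j))"
proof -
  let ?A = "(\<lambda>j. 2 * j) ` {1..sum_mset M}"
  have "set_mset (filter_mset even M) \<subseteq> ?A"
  proof
    fix k assume "k \<in># filter_mset even M"
    then have k: "k \<in># M" "even k" by auto
    then obtain j where j: "k = 2 * j" by blast
    have "j \<noteq> 0" using assms j k by (intro notI) auto
    moreover have "k \<le> sum_mset M"
      using k by (metis insert_DiffM le_add1 sum_mset.add_mset)
    ultimately show "k \<in> ?A"
      using j by auto
  qed
  then have "sum_mset (filter_mset even M) = (\<Sum>k\<in>?A. k * count (filter_mset even M) k)"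
    by (intro sum_mset_eq_sum_count) simp
  also have "\<dots> = (\<Sum>j=1..sum_mset M. 2 * j * count M (2 * j))"
    by (subst sum.reindex) (auto simp: inj_on_def)
  finally show ?thesis .
qed

text \<open>Group the pairs by \<open>i = j * m\<close>: the constraint becomes
  \<open>2 * i \<le> n\<close>, \<open>f\<close> depends on \<open>i\<close> only, and the weights
  \<open>j\<close> run over the divisors of \<open>i\<close>, adding up to
  \<open>sigma i\<close>.\<close>

lemma sum_divisor_pairs:
  fixes f :: "nat \<Rightarrow> nat"
  shows "(\<Sum>j=1..n. \<Sum>m | 1 \<le> m \<and> m * (2 * j) \<le> n. j * f (m * (2 * j)))
       = (\<Sum>i=1..n div 2. f (2 * i) * sigma i)"
proof -
  have fin: "finite {m. 1 \<le> m \<and> m * (2 * j) \<le> n}" if "j \<in> {1..n}" for j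
    by (rule finite_subset[of _ "{..n}"]) (use that le_of_mult_le[of _ "2 * j" n] in auto)
  have "(\<Sum>j=1..n. \<Sum>m | 1 \<le> m \<and> m * (2 * j) \<le> n. j * f (m * (2 * j)))
      = (\<Sum>(j, m)\<in>(SIGMA j:{1..n}. {m. 1 \<le> m \<and> m * (2 * j) \<le> n}). j * f (m * (2 * j)))"
    by (rule sum.Sigma) (use fin in auto)
  also have "\<dots> = (\<Sum>(i, d)\<in>(SIGMA i:{1..n div 2}. {d. d dvd i}). f (2 * i) * d)"
  proof (rule sum.reindex_bij_witness[where i = "\<lambda>(i, d). (d, i div d)" and j = "\<lambda>(j, m). (j * m, j)"],
      goal_cases)
    \<comment> \<open>Cases 2 and 4 check that \<open>(j * m, j)\<close> is a divisor pair in range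
      and that \<open>(d, i div d)\<close> meets the original bounds; both turn
      \<open>i \<le> n div 2\<close> into \<open>2 * i \<le> n\<close>.\<close>
    case (2 a)
    then show ?case by (auto simp: less_eq_div_iff_mult_less_eq mult_ac)
  next
    case (4 b)
    then obtain i d where b: "b = (i, d)" "1 \<le> i" "i \<le> n div 2" "d dvd i" by auto
    have "d \<le> i"
      using b by (intro dvd_imp_le) auto
    then have "d \<le> n"
      using b div_le_dividend[of n 2] by linarith
    moreover obtain m where m: "i = d * m"
      using b by blast
    have "0 < d" "0 < m"
      using b(2) m by (auto intro: gr0I)
    moreover have "m * (2 * d) \<le> n"
      using b(3) m by (simp add: less_eq_div_iff_mult_less_eq mult_ac)
    ultimately show ?case
      using b(1) m by auto
  qed (auto simp: mult_ac)
  also have "\<dots> = (\<Sum>i=1..n div 2. \<Sum>d | d dvd i. f (2 * i) * d)"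
    by (rule sum.Sigma[symmetric]) (auto intro: finite_divisors_nat)
  finally show ?thesis
    by (simp add: sigma_def sum_distrib_left)
qed

lemma sum_even_parts:
  "(\<Sum>xs\<in>partitions n. sum_list (filter even xs)) = 2 * (\<Sum>i=1..n div 2. p (n - 2 * i) * sigma i)"
proof -
  have "(\<Sum>xs\<in>partitions n. sum_list (filter even xs))
      = (\<Sum>xs\<in>partitions n. sum_mset (filter_mset even (mset xs)))"
    by (simp add: sum_mset_sum_list flip: mset_filter)
  also have "\<dots> = (\<Sum>M\<in>mset_partitions n. sum_mset (filter_mset even M))"
    by (rule sum.reindex_bij_betw[OF bij_betw_mset_partitions])
  also have "\<dots> = (\<Sum>M\<in>mset_partitions n. \<Sum>j=1..n. 2 * j * count M (2 * j))"
    by (rule sum.cong) (auto simp: mset_partitions_def sum_mset_filter_even)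
  also have "\<dots> = (\<Sum>j=1..n. 2 * j * (\<Sum>M\<in>mset_partitions n. count M (2 * j)))"
    by (subst sum.swap) (simp only: sum_distrib_left)
  also have "\<dots> = (\<Sum>j=1..n. 2 * j * (\<Sum>m | 1 \<le> m \<and> m * (2 * j) \<le> n. p (n - m * (2 * j))))"
    by (intro sum.cong refl arg_cong2[where f = "(*)"] sum_count_mset_partitions) auto
  \<comment> \<open>The part \<open>2 * j\<close> splits into the global factor 2 and the weight
    \<open>j\<close> that \<open>sigma\<close> collects.\<close>
  also have "\<dots> = 2 * (\<Sum>j=1..n. \<Sum>m | 1 \<le> m \<and> m * (2 * j) \<le> n. j * p (n - m * (2 * j)))"
    by (simp only: sum_distrib_left mult.assoc)
  finally show ?thesis
    by (simp only: sum_divisor_pairs[where f = "\<lambda>i. p (n - i)"])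
qed

lemma sum_list_filter_odd_even:
  "sum_list (filter odd xs) + sum_list (filter even xs) = sum_list xs" for xs :: "nat list"
  by (induction xs) auto

theorem theorem3p1:
  fixes n :: nat
  assumes "n \<ge> 1"
  shows "SOME_diff n + 4 * (\<Sum>i = 1..n div 2. int (p (n - 2 * i)) * int (sigma i)) =
    int n * int (p n)"
proof -
  let ?O = "\<Sum>xs\<in>partitions n. sum_list (filter odd xs)"
  let ?E = "\<Sum>xs\<in>partitions n. sum_list (filter even xs)"
  have "?O + ?E = (\<Sum>xs\<in>partitions n. n)"
    unfolding sum.distrib[symmetric] sum_list_filter_odd_even
    by (rule sum.cong) (auto simp: partitions_def)
  then have "int ?O + int ?E = int n * int (p n)"
    by (simp add: p_def mult.commute flip: of_nat_add of_nat_mult of_nat_sum)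
  \<comment> \<open>Four times the convolution is therefore \<open>2 * ?E\<close>, which turns
    \<open>?O - ?E\<close> into \<open>?O + ?E\<close>.\<close>
  moreover have "int ?E = 2 * (\<Sum>i = 1..n div 2. int (p (n - 2 * i)) * int (sigma i))"
    by (simp add: sum_even_parts)
  ultimately show ?thesis
    unfolding SOME_diff_def by linarith
qed

end
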